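(* Let $F(n)=\sum_{\pi\in S_n}q^{(a-cb)(\pi)}$ for $n\ge0$ (so $F(0)=1$). For $n,k\ge1$ let $$a(n,k)=\sum_{n\ge t_1>\cdots>t_k\ge1}\ \prod_{j=1}^{k-1}\bigl(q^{t_{j+1}+j-k}-1\bigr),\qquad b(n,k)=\sum_{n\ge t_1>\cdots>t_k\ge1}\ \prod_{j=1}^{k}\bigl(q^{t_j+j-k-1}-1\bigr).$$ Then for all $n\ge1$, $$F(n)=\sum_{k=1}^n a(n,k)F(n-k),$$ and for all $n,k\ge2$, $$a(n,k)=a(n-1,k)+b(n-1,k-1),\qquad b(n,k)=b(n-1,k)+(q^{n-k}-1)\,b(n-1,k-1),$$ with $a(n,1)=n$ and $b(n,1)=\sum_{i=1}^n(q^{i-1}-1)$ for $n\ge1$, $a(n,k)=0$ for $k\ge n$, $k\ge2$, and $b(n,k)=0$ for $k\ge n$. The same recurrence for $F$ (with the same $a(n,k)$) holds when $(a-cb)$ is replaced by its reversal, its complement, or its reverse-complement.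
   Context: $S_n$ is the set of permutations $\pi=\pi_1\cdots\pi_n$ of $\{1,\dots,n\}$ in one-line notation. $(a-cb)(\pi)$ is the number of pairs $(i,j)$ with $1\le i<j<n$ and $\pi_i<\pi_{j+1}<\pi_j$. The sums are over integer tuples $(t_1,\dots,t_k)$; empty sums are $0$ and empty products are $1$. For a statistic $\sigma$, the reversal, complement and reverse-complement are $\sigma^r(\pi)=\sigma(\pi^r)$, $\sigma^c(\pi)=\sigma(\pi^c)$ and $\sigma^{cr}(\pi)=\sigma((\pi^c)^r)$, where $\pi^r=\pi_n\cdots\pi_1$ and $\pi^c=(n+1-\pi_1)\cdots(n+1-\pi_n)$. *)

theory Defs
  imports Complex_Main "HOL-Combinatorics.Multiset_Permutations"
begin

text \<open>
  A permutation of \<open>{1..n}\<close> in one-line notation is an element of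
  \<^term>\<open>permutations_of_set {1..n::nat}\<close>. Lists are indexed from 0, so the entry
  $\pi_i$ is \<open>\<pi> ! (i - 1)\<close>.
\<close>

definition a_cb :: "nat list \<Rightarrow> nat" where
  "a_cb \<pi> = card {(i, j). 1 \<le> i \<and> i < j \<and> j < length \<pi> \<and>
                     \<pi> ! (i - 1) < \<pi> ! ((j + 1) - 1) \<and> \<pi> ! ((j + 1) - 1) < \<pi> ! (j - 1)}"

definition perm_compl :: "nat list \<Rightarrow> nat list" where
  "perm_compl \<pi> = map (\<lambda>x. length \<pi> + 1 - x) \<pi>"

definition stat_rev :: "(nat list \<Rightarrow> nat) \<Rightarrow> nat list \<Rightarrow> nat" where
  "stat_rev \<sigma> \<pi> = \<sigma> (rev \<pi>)"

definition stat_compl :: "(nat list \<Rightarrow> nat) \<Rightarrow> nat list \<Rightarrow> nat" where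
  "stat_compl \<sigma> \<pi> = \<sigma> (perm_compl \<pi>)"

definition stat_rev_compl :: "(nat list \<Rightarrow> nat) \<Rightarrow> nat list \<Rightarrow> nat" where
  "stat_rev_compl \<sigma> \<pi> = \<sigma> (rev (perm_compl \<pi>))"

definition stat_gf :: "(nat list \<Rightarrow> nat) \<Rightarrow> 'a::field \<Rightarrow> nat \<Rightarrow> 'a" where
  "stat_gf \<sigma> q n = (\<Sum>\<pi>\<in>permutations_of_set {1..n}. q ^ \<sigma> \<pi>)"

definition dec_tuples :: "nat \<Rightarrow> nat \<Rightarrow> (nat \<Rightarrow> int) set" where
  "dec_tuples n k = {t \<in> {1..k} \<rightarrow>\<^sub>E {1..int n}. \<forall>j\<in>{1..<k}. t j > t (j + 1)}"

text \<open>
  The indeterminate $q$ is an arbitrary element of an arbitrary field, e.g. the generator of a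
  field of rational functions. The exponents below are integers and, for \<open>t\<close> in
  \<^const>\<open>dec_tuples\<close>, never negative.
\<close>

definition coeff_a :: "'a::field \<Rightarrow> nat \<Rightarrow> nat \<Rightarrow> 'a" where
  "coeff_a q n k = (\<Sum>t\<in>dec_tuples n k. \<Prod>j\<in>{1..<k}. (q powi (t (j + 1) + int j - int k) - 1))"

definition coeff_b :: "'a::field \<Rightarrow> nat \<Rightarrow> nat \<Rightarrow> 'a" where
  "coeff_b q n k = (\<Sum>t\<in>dec_tuples n k. \<Prod>j\<in>{1..k}. (q powi (t j + int j - int k - 1) - 1))"

end

theory Submission
  imports Defs
begin

text \<open>
  Appending a last entry \<open>v\<close> to a permutation of \<open>{1..n}\<close> creates new occurrences only when it
  creates a descent, and then exactly \<open>v - 1\<close> of them. So if $G(n,v)$ is the part of $F(n)$ coming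
  from the permutations ending in $v$, then $G(n+1,v) = F(n) + x_v \sum_{u \ge v} G(n,u)$ with
  $x_v = q^{v-1} - 1$. Iterating this $r$ times in $F(n) = \sum_v G(n,v)$ leaves the remainder
  $\sum_u h_r(x_1,\dots,x_u)\, G(n-r,u)$, where $h_r$ is the complete homogeneous symmetric
  polynomial. The coefficients satisfy
  $b(n,k) = h_k(x_1,\dots,x_{n+1-k})$ and $a(n,k) = \sum_{u \le n+1-k} h_{k-1}(x_1,\dots,x_u)$.
\<close>

section \<open>The coefficients as complete homogeneous sums\<close>

text \<open>With x_u = \<open>q ^ (u - 1) - 1\<close>, this is the complete homogeneous polynomial
  of degree \<open>k\<close> in x_1, ..., x_m. The recursion splits off the largest index
  \<open>u\<close> of a monomial, counted once.\<close>

fun homog :: "'a::field \<Rightarrow> nat \<Rightarrow> nat \<Rightarrow> 'a" where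
  "homog q 0 m = 1"
| "homog q (Suc k) m = (\<Sum>u=1..m. (q ^ (u - 1) - 1) * homog q k u)"

text \<open>The default \<open>undefined\<close> keeps the result in the extensional function space
  on \<open>{1..Suc k}\<close> that \<open>dec_tuples\<close> requires.\<close>

definition tuple_cons :: "nat \<Rightarrow> int \<Rightarrow> (nat \<Rightarrow> int) \<Rightarrow> nat \<Rightarrow> int" where
  "tuple_cons k x t =
     (\<lambda>j. if j = 1 then x else if j \<in> {1..Suc k} then t (j - 1) else undefined)"

section \<open>Decreasing tuples, split by their first entry\<close>

lemma finite_dec_tuples [simp]: "finite (dec_tuples n k)"
proof (rule finite_subset)
  show "dec_tuples n k \<subseteq> {1..k} \<rightarrow>\<^sub>E {1..int n}"
    by (auto simp: dec_tuples_def)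
qed (simp add: finite_PiE)

lemma dec_tuples_0_right: "dec_tuples n 0 = {\<lambda>_. undefined}"
  by (auto simp: dec_tuples_def)

lemma dec_tuples_0_left: "k \<ge> 1 \<Longrightarrow> dec_tuples 0 k = {}"
  by (auto simp: dec_tuples_def PiE_eq_empty_iff)

lemma dec_tuples_le_first:
  assumes "t \<in> dec_tuples n k" "1 \<le> j" "j \<le> k"
  shows "t j \<le> t 1"
  using assms(2,3)
proof (induction j rule: dec_induct)
  case (step j)
  then have "t (j + 1) < t j"
    using assms(1) by (auto simp: dec_tuples_def)
  with step show ?case by simp
qed simp

lemma dec_tuples_SucI:
  assumes "t \<in> dec_tuples n k"
  shows "t \<in> dec_tuples (Suc n) k"
proof -
  have "{1..int n} \<subseteq> {1..int (Suc n)}" by auto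
  with assms show ?thesis
    unfolding dec_tuples_def by (fastforce simp: PiE_iff)
qed

lemma tuple_cons_in_dec_tuples:
  assumes "t \<in> dec_tuples n k"
  shows "tuple_cons k (int (Suc n)) t \<in> dec_tuples (Suc n) (Suc k)"
proof -
  have range: "1 \<le> t j" "t j \<le> int n" if "1 \<le> j" "j \<le> k" for j
    using assms that by (auto simp: dec_tuples_def PiE_iff)
  have dec: "t (j + 1) < t j" if "1 \<le> j" "j < k" for j
    using assms that by (auto simp: dec_tuples_def)
  have "tuple_cons k (int (Suc n)) t \<in> {1..Suc k} \<rightarrow>\<^sub>E {1..int (Suc n)}"
  proof (rule PiE_I)
    fix j assume j: "j \<in> {1..Suc k}"
    show "tuple_cons k (int (Suc n)) t j \<in> {1..int (Suc n)}"
    proof (cases "j = 1")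
      case False
      with j have "1 \<le> j - 1" "j - 1 \<le> k" by auto
      with range[of "j - 1"] False j show ?thesis by (simp add: tuple_cons_def)
    qed (simp add: tuple_cons_def)
  qed (auto simp: tuple_cons_def)
  moreover have "tuple_cons k (int (Suc n)) t (j + 1) < tuple_cons k (int (Suc n)) t j"
    if "j \<in> {1..<Suc k}" for j
    using that range[of 1] dec[of "j - 1"] by (auto simp: tuple_cons_def)
  ultimately show ?thesis by (simp add: dec_tuples_def)
qed

text \<open>The first entry is the maximum. Either it equals \<open>Suc n\<close> and the tail is
  bounded by \<open>n\<close>, or it is at most \<open>n\<close> and so is every other
  entry.\<close>

lemma dec_tuples_Suc_cases:
  assumes t: "t \<in> dec_tuples (Suc n) (Suc k)"
  obtains "t \<in> dec_tuples n (Suc k)"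
  | s where "s \<in> dec_tuples n k" "t = tuple_cons k (int (Suc n)) s"
proof -
  have PiE: "t \<in> {1..Suc k} \<rightarrow>\<^sub>E {1..int (Suc n)}"
    and dec: "\<And>j. j \<in> {1..<Suc k} \<Longrightarrow> t (j + 1) < t j"
    using t by (auto simp: dec_tuples_def)
  have range: "1 \<le> t j" "t j \<le> int (Suc n)" if "1 \<le> j" "j \<le> Suc k" for j
    using PiE that by (auto simp: PiE_iff)
  have undef: "t j = undefined" if "j \<notin> {1..Suc k}" for j
    using PiE_arb[OF PiE that] .
  show ?thesis
  proof (cases "t 1 = int (Suc n)")
    case True
    define s where "s = (\<lambda>j. if j \<in> {1..k} then t (j + 1) else undefined)"
    \<comment> \<open>Strict descent at \<open>j\<close> puts this entry below \<open>t j\<close>,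
      which is at most \<open>t 1\<close>.\<close>
    have "t (j + 1) \<le> int n" if "1 \<le> j" "j \<le> k" for j
      using dec[of j] dec_tuples_le_first[OF t, of j] that True by simp
    then have "s \<in> dec_tuples n k"
      using range dec by (auto simp: dec_tuples_def s_def PiE_iff extensional_def)
    moreover have "t = tuple_cons k (int (Suc n)) s"
      using True undef by (auto simp: tuple_cons_def s_def fun_eq_iff)
    ultimately show ?thesis using that by blast
  next
    case False
    have "t j \<le> int n" if "1 \<le> j" "j \<le> Suc k" for j
      using dec_tuples_le_first[OF t that] range[of 1] False by simp
    then have "t \<in> dec_tuples n (Suc k)"
      using range dec undef by (auto simp: dec_tuples_def PiE_iff extensional_def)
    then show ?thesis using that by blast
  qed
qed

lemma dec_tuples_Suc:
  "dec_tuples (Suc n) (Suc k) =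
     dec_tuples n (Suc k) \<union> tuple_cons k (int (Suc n)) ` dec_tuples n k"
  using dec_tuples_SucI tuple_cons_in_dec_tuples
  by (blast elim: dec_tuples_Suc_cases)

text \<open>The tail determines a tuple starting with \<open>Suc n\<close>, and no such tuple has
  its entries in \<open>{1..int n}\<close>; the decomposition is thus disjoint and can be summed
  termwise.\<close>

lemma sum_dec_tuples_Suc:
  "(\<Sum>t\<in>dec_tuples (Suc n) (Suc k). f t) =
     (\<Sum>t\<in>dec_tuples n (Suc k). f t) + (\<Sum>t\<in>dec_tuples n k. f (tuple_cons k (int (Suc n)) t))"
proof -
  have "inj_on (tuple_cons k (int (Suc n))) (dec_tuples n k)"
  proof (rule inj_onI)
    fix s t assume st: "s \<in> dec_tuples n k" "t \<in> dec_tuples n k"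
      and eq: "tuple_cons k (int (Suc n)) s = tuple_cons k (int (Suc n)) t"
    have "s j = t j" if "j \<in> {1..k}" for j
      using fun_cong[OF eq, of "Suc j"] that by (simp add: tuple_cons_def)
    moreover have "s \<in> {1..k} \<rightarrow>\<^sub>E {1..int n}" "t \<in> {1..k} \<rightarrow>\<^sub>E {1..int n}"
      using st by (simp_all add: dec_tuples_def)
    ultimately show "s = t" by (intro PiE_ext[of s "{1..k}" "\<lambda>_. {1..int n}" t])
  qed
  moreover have "dec_tuples n (Suc k) \<inter> tuple_cons k (int (Suc n)) ` dec_tuples n k = {}"
    by (force simp: dec_tuples_def tuple_cons_def PiE_iff)
  ultimately show ?thesis
    by (simp add: dec_tuples_Suc sum.union_disjoint sum.reindex)
qed

section \<open>Recurrences and closed forms of the coefficients\<close>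

lemma coeff_b_Suc_Suc:
  "coeff_b q (Suc n) (Suc k) =
     coeff_b q n (Suc k) + (q powi (int n - int k) - 1) * coeff_b q n k"
proof -
  have "(\<Prod>j\<in>{1..Suc k}. q powi (tuple_cons k (int (Suc n)) t j + int j - int (Suc k) - 1) - 1) =
        (q powi (int n - int k) - 1) * (\<Prod>j\<in>{1..k}. q powi (t j + int j - int k - 1) - 1)" for t
  proof -
    \<comment> \<open>The new first entry has exponent (n + 1) + 1 - (k + 1) - 1 = n - k.\<close>
    have "(\<Prod>j\<in>{1..Suc k}. q powi (tuple_cons k (int (Suc n)) t j + int j - int (Suc k) - 1) - 1) =
          (q powi (int n - int k) - 1) *
          (\<Prod>j\<in>{Suc 1..Suc k}. q powi (tuple_cons k (int (Suc n)) t j + int j - int (Suc k) - 1) - 1)"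
      by (subst prod.atLeast_Suc_atMost) (auto simp: tuple_cons_def)
    \<comment> \<open>The shift of the index \<open>j\<close> by one cancels the growth of the
      length by one, so the old exponents survive.\<close>
    also have "(\<Prod>j\<in>{Suc 1..Suc k}. q powi (tuple_cons k (int (Suc n)) t j + int j - int (Suc k) - 1) - 1) =
          (\<Prod>j\<in>{1..k}. q powi (t j + int j - int k - 1) - 1)"
      by (subst prod.shift_bounds_cl_Suc_ivl, rule prod.cong) (auto simp: tuple_cons_def algebra_simps)
    finally show ?thesis .
  qed
  then show ?thesis
    unfolding coeff_b_def sum_dec_tuples_Suc by (simp only: sum_distrib_left)
qed

text \<open>The product in \<open>coeff_a\<close> omits the first entry. A new first entry
  \<open>Suc n\<close> therefore contributes no factor, and the tail carries exactly the product of
  \<open>coeff_b\<close>.\<close>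

lemma coeff_a_Suc_Suc:
  "coeff_a q (Suc n) (Suc k) = coeff_a q n (Suc k) + coeff_b q n k"
proof -
  have "(\<Prod>j\<in>{1..<Suc k}. q powi (tuple_cons k (int (Suc n)) t (j + 1) + int j - int (Suc k)) - 1) =
        (\<Prod>j\<in>{1..k}. q powi (t j + int j - int k - 1) - 1)" for t
    by (rule prod.cong) (auto simp: tuple_cons_def algebra_simps)
  then show ?thesis
    unfolding coeff_a_def coeff_b_def sum_dec_tuples_Suc by simp
qed

text \<open>The recurrence for \<open>coeff_b\<close> is the identity h_{l+1}(x_1,...,x_{m+1}) =
  h_{l+1}(x_1,...,x_m) + x_{m+1} h_l(x_1,...,x_{m+1}) with m = n - l.\<close>

lemma coeff_b_eq_homog: "coeff_b q n k = homog q k (n + 1 - k)"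
proof (induction n arbitrary: k)
  case 0
  show ?case
    by (cases k) (simp_all add: coeff_b_def dec_tuples_0_right dec_tuples_0_left)
next
  case (Suc n)
  show ?case
  proof (cases k)
    case 0
    then show ?thesis by (simp add: coeff_b_def dec_tuples_0_right)
  next
    case (Suc l)
    show ?thesis
    proof (cases "l \<le> n")
      case True
      then have "q powi (int n - int l) = q ^ (n - l)"
        by (simp flip: of_nat_diff)
      moreover have "Suc n - l = Suc (n - l)" using True by simp
      ultimately show ?thesis
        using Suc.IH[of l] Suc.IH[of k] Suc by (simp add: coeff_b_Suc_Suc)
    next
      \<comment> \<open>All second arguments of \<open>homog\<close> truncate to 0 while the degrees
        are positive, so every term vanishes, whatever the factor with negative exponent is.\<close>
      case False
      then show ?thesis
        using Suc.IH[of l] Suc.IH[of k] Suc by (cases l) (simp_all add: coeff_b_Suc_Suc)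
    qed
  qed
qed

text \<open>Unrolling \<open>coeff_a_Suc_Suc\<close> in \<open>n\<close> accumulates the values of
  \<open>coeff_b\<close>, each of which is one summand on the right.\<close>

lemma coeff_a_eq_homog: "coeff_a q n (Suc k) = (\<Sum>u=1..n - k. homog q k u)"
proof (induction n)
  case 0
  show ?case by (simp add: coeff_a_def dec_tuples_0_left)
next
  case (Suc n)
  show ?case
  proof (cases "k \<le> n")
    case True
    then show ?thesis
      using Suc by (simp add: coeff_a_Suc_Suc coeff_b_eq_homog Suc_diff_le)
  next
    case False
    then show ?thesis
      using Suc by (cases k) (simp_all add: coeff_a_Suc_Suc coeff_b_eq_homog)
  qed
qed

text \<open>Since x_1 = \<open>q ^ 0 - 1\<close> is zero, a homogeneous polynomial of positive
  degree in x_1 alone vanishes. This is the source of the zero coefficients.\<close>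

lemma homog_Suc_eq_0: "m \<le> 1 \<Longrightarrow> homog q (Suc k) m = 0"
  by (cases m) auto

lemma coeff_b_eq_0: "1 \<le> k \<Longrightarrow> n \<le> k \<Longrightarrow> coeff_b q n k = 0"
  using homog_Suc_eq_0[of "n + 1 - k" q "k - 1"] by (simp add: coeff_b_eq_homog)

lemma coeff_a_eq_0:
  assumes "2 \<le> k" "n \<le> k"
  shows "coeff_a q n k = 0"
proof -
  obtain l where k: "k = Suc (Suc l)"
    using assms(1) by (metis Suc_le_D numeral_2_eq_2 le_Suc_eq)
  have "homog q (Suc l) u = 0" if "u \<in> {1..n - Suc l}" for u
    using that assms k by (intro homog_Suc_eq_0) auto
  then show ?thesis
    unfolding k coeff_a_eq_homog by (intro sum.neutral) blast
qed

section \<open>Appending a last entry\<close>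

text \<open>The increasing embedding of the naturals whose image misses exactly \<open>v\<close>; it
  makes room for \<open>v\<close> as a new entry.\<close>

definition skip_value :: "nat \<Rightarrow> nat \<Rightarrow> nat" where
  "skip_value v x = (if x < v then x else Suc x)"

definition append_value :: "nat \<Rightarrow> nat list \<Rightarrow> nat list" where
  "append_value v \<pi> = map (skip_value v) \<pi> @ [v]"

lemma skip_value_less_iff [simp]: "skip_value v x < skip_value v y \<longleftrightarrow> x < y"
  by (auto simp: skip_value_def)

lemma skip_value_neq [simp]: "skip_value v x \<noteq> v" "v \<noteq> skip_value v x"
  by (auto simp: skip_value_def)

lemma inj_skip_value: "inj (skip_value v)"
  by (rule injI) (auto simp: skip_value_def split: if_splits)

lemma skip_value_image:
  assumes "v \<in> {1..Suc n}"
  shows "skip_value v ` {1..n} = {1..Suc n} - {v}"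
proof
  show "{1..Suc n} - {v} \<subseteq> skip_value v ` {1..n}"
  proof
    fix y assume y: "y \<in> {1..Suc n} - {v}"
    then have "y = skip_value v (if y < v then y else y - 1)"
      by (auto simp: skip_value_def)
    moreover have "(if y < v then y else y - 1) \<in> {1..n}"
      using y assms by auto
    ultimately show "y \<in> skip_value v ` {1..n}" by blast
  qed
qed (use assms in \<open>auto simp: skip_value_def\<close>)

text \<open>The inverse deletes the last entry and closes the gap left at \<open>v\<close>.\<close>

lemma bij_betw_append_value:
  assumes "v \<in> {1..Suc n}"
  shows "bij_betw (append_value v) (permutations_of_set {1..n})
           {\<pi> \<in> permutations_of_set {1..Suc n}. last \<pi> = v}"
proof (rule bij_betwI')
  fix \<pi> \<rho> :: "nat list"
  show "append_value v \<pi> = append_value v \<rho> \<longleftrightarrow> \<pi> = \<rho>"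
    by (simp add: append_value_def inj_map_eq_map[OF inj_skip_value])
next
  fix \<pi> assume "\<pi> \<in> permutations_of_set {1..n}"
  then have \<pi>: "set \<pi> = {1..n}" "distinct \<pi>"
    by (auto simp: permutations_of_set_def)
  have "insert v (skip_value v ` {1..n}) = {1..Suc n}"
    using assms unfolding skip_value_image[OF assms] by auto
  with \<pi> have "set (append_value v \<pi>) = {1..Suc n}"
    by (simp add: append_value_def)
  with \<pi> show "append_value v \<pi> \<in> {\<pi> \<in> permutations_of_set {1..Suc n}. last \<pi> = v}"
    by (auto simp: append_value_def permutations_of_set_def distinct_map
        intro: inj_on_subset[OF inj_skip_value])
next
  fix \<rho> assume \<rho>: "\<rho> \<in> {\<pi> \<in> permutations_of_set {1..Suc n}. last \<pi> = v}"
  then have \<rho>': "set \<rho> = {1..Suc n}" "distinct \<rho>" "last \<rho> = v"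
    by (auto simp: permutations_of_set_def)
  then have "\<rho> \<noteq> []" by auto
  then obtain \<sigma> where \<sigma>: "\<rho> = \<sigma> @ [v]"
    using \<rho>'(3) append_butlast_last_id by metis
  \<comment> \<open>The entries of \<open>\<sigma>\<close> avoid \<open>v\<close>, hence lie in the
    image of \<open>skip_value v\<close>, where \<open>inv\<close> is a genuine inverse.\<close>
  define \<pi> where "\<pi> = map (inv (skip_value v)) \<sigma>"
  have \<sigma>_set: "set \<sigma> = skip_value v ` {1..n}"
    using \<rho>' assms unfolding \<sigma> skip_value_image[OF assms] by auto
  then have map_\<pi>: "map (skip_value v) \<pi> = \<sigma>"
    unfolding \<pi>_def map_map o_def by (intro map_idI f_inv_into_f) auto
  have "set \<pi> = {1..n}"
    unfolding \<pi>_def set_map \<sigma>_set by (simp add: image_image inv_f_f[OF inj_skip_value])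
  moreover have "distinct \<pi>"
    using \<rho>'(2) distinct_map[of "skip_value v" \<pi>] by (simp add: map_\<pi> \<sigma>)
  ultimately have "\<rho> = append_value v \<pi>" "\<pi> \<in> permutations_of_set {1..n}"
    by (auto simp: append_value_def permutations_of_set_def map_\<pi> \<sigma>)
  then show "\<exists>\<pi>\<in>permutations_of_set {1..n}. \<rho> = append_value v \<pi>" by blast
qed

section \<open>The statistic after appending an entry\<close>

lemma a_cb_map:
  assumes "\<And>x y. f x < f y \<longleftrightarrow> x < y"
  shows "a_cb (map f \<pi>) = a_cb \<pi>"
  unfolding a_cb_def by (intro arg_cong[where f = card]) (auto simp: assms)

lemma finite_a_cb_pairs:
  "finite {(i, j). 1 \<le> i \<and> i < j \<and> j < length \<pi> \<and>
      \<pi> ! (i - 1) < \<pi> ! ((j + 1) - 1) \<and> \<pi> ! ((j + 1) - 1) < \<pi> ! (j - 1)}"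
  by (rule finite_subset[of _ "{..length \<pi>} \<times> {..length \<pi>}"]) auto

text \<open>Pairs with \<open>j < length \<pi>\<close> see only \<open>\<pi>\<close>. A new pair has
  \<open>j = length \<pi>\<close>, so it compares an entry with \<open>v\<close> and
  \<open>v\<close> with the last entry; by distinctness, positions can be counted as values.\<close>

lemma a_cb_snoc:
  assumes "distinct \<pi>"
  shows "a_cb (\<pi> @ [v]) =
    a_cb \<pi> + (if \<pi> \<noteq> [] \<and> v < last \<pi> then card {x \<in> set \<pi>. x < v} else 0)"
proof -
  let ?m = "length \<pi>"
  define old where "old = {(i, j). 1 \<le> i \<and> i < j \<and> j < ?m \<and>
      \<pi> ! (i - 1) < \<pi> ! ((j + 1) - 1) \<and> \<pi> ! ((j + 1) - 1) < \<pi> ! (j - 1)}"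
  \<comment> \<open>These are the possible first components of a new pair, whose second component
    must be \<open>?m\<close>.\<close>
  define I where "I = {i. 1 \<le> i \<and> i < ?m \<and> \<pi> ! (i - 1) < v \<and> v < \<pi> ! (?m - 1)}"
  define new where "new = {(i, j). 1 \<le> i \<and> i < j \<and> j < length (\<pi> @ [v]) \<and>
      (\<pi> @ [v]) ! (i - 1) < (\<pi> @ [v]) ! ((j + 1) - 1) \<and>
      (\<pi> @ [v]) ! ((j + 1) - 1) < (\<pi> @ [v]) ! (j - 1)}"
  have "(i, j) \<in> new \<longleftrightarrow> (i, j) \<in> old \<union> (\<lambda>i. (i, ?m)) ` I" for i j
  proof -
    consider "\<not> i < j" | "i < j" "j < ?m" | "i < j" "j = ?m" | "?m < j" by linarith
    then show ?thesis
    proof cases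
      case 1
      then show ?thesis by (auto simp: new_def old_def I_def)
    next
      case 2
      then have "i - 1 < ?m" "j - 1 < ?m" by linarith+
      with 2 show ?thesis by (auto simp: new_def old_def nth_append_left)
    next
      case 3
      then have "i - 1 < ?m" "j - 1 < ?m" by linarith+
      with 3 show ?thesis by (auto simp: new_def old_def I_def nth_append_left)
    next
      case 4
      then show ?thesis by (auto simp: new_def old_def I_def)
    qed
  qed
  then have "new = old \<union> (\<lambda>i. (i, ?m)) ` I"
    by (simp only: set_eq_iff split_paired_All) blast
  moreover have "finite old"
    unfolding old_def by (rule finite_a_cb_pairs)
  moreover have "finite I" unfolding I_def by simp
  moreover have "old \<inter> (\<lambda>i. (i, ?m)) ` I = {}" by (auto simp: old_def)
  ultimately have "a_cb (\<pi> @ [v]) = card old + card I"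
    unfolding a_cb_def new_def[symmetric] by (simp add: card_Un_disjoint card_image inj_on_def)
  moreover have "card I = (if \<pi> \<noteq> [] \<and> v < last \<pi> then card {x \<in> set \<pi>. x < v} else 0)"
  proof (cases "\<pi> \<noteq> [] \<and> v < last \<pi>")
    case True
    then have last: "v < \<pi> ! (?m - 1)" using last_conv_nth[of \<pi>] by auto
    have "(\<lambda>i. \<pi> ! (i - 1)) ` I = {x \<in> set \<pi>. x < v}"
    proof (intro equalityI subsetI)
      fix x assume "x \<in> {x \<in> set \<pi>. x < v}"
      then obtain i where i: "i < ?m" "x = \<pi> ! i" "x < v"
        by (auto simp: in_set_conv_nth)
      \<comment> \<open>The last entry exceeds \<open>v\<close>, so the position of a smaller entry
        satisfies the strict bound \<open>Suc i < ?m\<close> required by \<open>I\<close>.\<close>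
      moreover from this last have "i \<noteq> ?m - 1" by auto
      ultimately have "Suc i \<in> I" using last by (auto simp: I_def)
      then show "x \<in> (\<lambda>i. \<pi> ! (i - 1)) ` I" using i by force
    qed (auto simp: I_def)
    moreover have "inj_on (\<lambda>i. \<pi> ! (i - 1)) I"
      using assms by (auto simp: inj_on_def I_def nth_eq_iff_index_eq)
    ultimately show ?thesis using True by (metis card_image)
  next
    case False
    then have "I = {}" using last_conv_nth[of \<pi>] by (cases "\<pi> = []") (auto simp: I_def)
    then show ?thesis using False by auto
  qed
  ultimately show ?thesis by (simp add: a_cb_def old_def)
qed

text \<open>Relabelling leaves all of \<open>{1..<v}\<close> in front of the new entry, and it turns
  the strict comparison with the last entry into \<open>v \<le> last \<pi>\<close>.\<close>

lemma a_cb_append_value: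
  assumes \<pi>: "\<pi> \<in> permutations_of_set {1..n}" and v: "v \<in> {1..Suc n}"
  shows "a_cb (append_value v \<pi>) = a_cb \<pi> + (if \<pi> \<noteq> [] \<and> v \<le> last \<pi> then v - 1 else 0)"
proof -
  have \<pi>': "set \<pi> = {1..n}" "distinct \<pi>" using \<pi> by (auto simp: permutations_of_set_def)
  have "distinct (map (skip_value v) \<pi>)"
    using \<pi>' by (auto simp: distinct_map intro: inj_on_subset[OF inj_skip_value])
  moreover have "card {x \<in> set (map (skip_value v) \<pi>). x < v} = v - 1"
  proof -
    have "{x \<in> set (map (skip_value v) \<pi>). x < v} = {1..<v}"
      using v unfolding set_map \<pi>' skip_value_image[OF v] by auto
    then show ?thesis by simp
  qed
  moreover have "v < last (map (skip_value v) \<pi>) \<longleftrightarrow> v \<le> last \<pi>" if "\<pi> \<noteq> []"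
    using that by (auto simp: last_map skip_value_def)
  ultimately show ?thesis
    by (auto simp: append_value_def a_cb_snoc a_cb_map)
qed

section \<open>The recurrence\<close>

text \<open>This is G(n,v) of the overview. For \<open>n = 0\<close> it refers to the unspecified
  \<open>last []\<close>, but the recurrences then sum it over empty ranges only.\<close>

definition gf_last :: "'a::field \<Rightarrow> nat \<Rightarrow> nat \<Rightarrow> 'a" where
  "gf_last q n v = (\<Sum>\<pi> | \<pi> \<in> permutations_of_set {1..n} \<and> last \<pi> = v. q ^ a_cb \<pi>)"

lemma sum_gf_last:
  assumes "A \<subseteq> {1..n}" "n \<ge> 1"
  shows "(\<Sum>u\<in>A. gf_last q n u) =
    (\<Sum>\<pi> | \<pi> \<in> permutations_of_set {1..n} \<and> last \<pi> \<in> A. q ^ a_cb \<pi>)"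
proof -
  have "finite A" using assms finite_subset by blast
  have "(\<Sum>u\<in>A. gf_last q n u) = (\<Sum>u\<in>A. \<Sum>\<pi> | \<pi> \<in>
      {\<pi> \<in> permutations_of_set {1..n}. last \<pi> \<in> A} \<and> last \<pi> = u. q ^ a_cb \<pi>)"
    unfolding gf_last_def by (intro sum.cong) auto
  also have "\<dots> = (\<Sum>\<pi>\<in>{\<pi> \<in> permutations_of_set {1..n}. last \<pi> \<in> A}. q ^ a_cb \<pi>)"
    using \<open>finite A\<close> by (intro sum.group) auto
  finally show ?thesis .
qed

lemma last_permutation_in:
  fixes \<pi> :: "nat list"
  assumes "\<pi> \<in> permutations_of_set {1..n}" "n \<ge> 1"
  shows "\<pi> \<noteq> []" "last \<pi> \<in> {1..n}"
proof -
  have *: "set \<pi> = {1..n}" using assms by (simp add: permutations_of_set_def)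
  with assms(2) have "n \<in> set \<pi>" by simp
  then show "\<pi> \<noteq> []" by auto
  with * show "last \<pi> \<in> {1..n}" using last_in_set by blast
qed

lemma stat_gf_eq_sum_gf_last:
  assumes "n \<ge> 1"
  shows "stat_gf a_cb q n = (\<Sum>u=1..n. gf_last q n u)"
  using last_permutation_in[OF _ assms]
  unfolding stat_gf_def sum_gf_last[OF order_refl assms] by (intro sum.cong) auto

lemma gf_last_Suc:
  assumes v: "v \<in> {1..Suc n}"
  shows "gf_last q (Suc n) v = stat_gf a_cb q n + (q ^ (v - 1) - 1) * (\<Sum>u=v..n. gf_last q n u)"
proof -
  let ?P = "permutations_of_set {1..n}"
  let ?D = "{\<pi> \<in> ?P. \<pi> \<noteq> [] \<and> v \<le> last \<pi>}"
  have "gf_last q (Suc n) v = (\<Sum>\<pi>\<in>?P. q ^ a_cb (append_value v \<pi>))"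
    unfolding gf_last_def
    using sum.reindex_bij_betw[OF bij_betw_append_value[OF v], of "\<lambda>\<pi>. q ^ a_cb \<pi>"] by simp
  \<comment> \<open>The weight gained is split as q^(v-1) = 1 + (q^(v-1) - 1), so that the sum of
    the unchanged weights is the full generating function.\<close>
  also have "\<dots> = (\<Sum>\<pi>\<in>?P. q ^ a_cb \<pi> +
      (if \<pi> \<noteq> [] \<and> v \<le> last \<pi> then (q ^ (v - 1) - 1) * q ^ a_cb \<pi> else 0))"
    using v by (intro sum.cong) (auto simp: a_cb_append_value power_add algebra_simps)
  also have "\<dots> = stat_gf a_cb q n + (q ^ (v - 1) - 1) * (\<Sum>\<pi>\<in>?D. q ^ a_cb \<pi>)"
    unfolding sum.distrib stat_gf_def sum_distrib_left by (simp add: sum.inter_filter cong: if_cong)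
  also have "(\<Sum>\<pi>\<in>?D. q ^ a_cb \<pi>) = (\<Sum>u=v..n. gf_last q n u)"
  proof (cases "n \<ge> 1")
    case True
    have "?D = {\<pi> \<in> ?P. last \<pi> \<in> {v..n}}"
      using last_permutation_in[OF _ True] by fastforce
    then show ?thesis using v by (subst sum_gf_last[OF _ True]) auto
  next
    case False
    then have "?D = {}" by auto
    then show ?thesis using False v by (simp only: sum.empty) simp
  qed
  finally show ?thesis .
qed

text \<open>Each step rewrites the remainder by \<open>gf_last_Suc\<close>: the constant part yields
  the next coefficient, and exchanging the double sum raises the degree of \<open>homog\<close> by
  one.\<close>

lemma stat_gf_expand:
  assumes "n \<ge> 1" "r \<le> n"
  shows "stat_gf a_cb q n = (\<Sum>k=1..r. coeff_a q n k * stat_gf a_cb q (n - k)) +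
           (\<Sum>u=1..n - r. homog q r u * gf_last q (n - r) u)"
  using assms(2)
proof (induction r)
  case 0
  show ?case by (simp add: stat_gf_eq_sum_gf_last[OF assms(1)])
next
  case (Suc r)
  define m where "m = n - Suc r"
  have m: "n - r = Suc m" using Suc.prems by (simp add: m_def)
  let ?x = "\<lambda>u. q ^ (u - 1) - 1"
  have "(\<Sum>u=1..Suc m. homog q r u * gf_last q (Suc m) u) =
        (\<Sum>u=1..Suc m. homog q r u * (stat_gf a_cb q m + ?x u * (\<Sum>w=u..m. gf_last q m w)))"
    by (intro sum.cong) (simp_all add: gf_last_Suc)
  also have "\<dots> = (\<Sum>u=1..Suc m. homog q r u) * stat_gf a_cb q m +
        (\<Sum>u=1..Suc m. \<Sum>w=u..m. ?x u * homog q r u * gf_last q m w)"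
    unfolding distrib_left sum.distrib sum_distrib_right sum_distrib_left
    by (simp add: mult_ac)
  \<comment> \<open>For \<open>u = Suc m\<close> the inner range is empty.\<close>
  also have "(\<Sum>u=1..Suc m. \<Sum>w=u..m. ?x u * homog q r u * gf_last q m w) =
        (\<Sum>u=1..m. \<Sum>w=u..m. ?x u * homog q r u * gf_last q m w)"
    by simp
  \<comment> \<open>Both sides run over the pairs with 1 \<le> u \<le> w \<le> m; the inner sum over
    \<open>u\<close> is then the recursion of \<open>homog\<close>.\<close>
  also have "\<dots> = (\<Sum>w=1..m. \<Sum>u=1..w. ?x u * homog q r u * gf_last q m w)"
    unfolding sum.Sigma[OF finite_atLeastAtMost ballI[OF finite_atLeastAtMost]]
    by (rule sum.reindex_bij_witness[of _ prod.swap prod.swap]) auto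
  also have "\<dots> = (\<Sum>w=1..m. homog q (Suc r) w * gf_last q m w)"
    by (simp add: sum_distrib_right)
  also have "(\<Sum>u=1..Suc m. homog q r u) = coeff_a q n (Suc r)"
    by (simp add: coeff_a_eq_homog m)
  finally show ?case
    using Suc m by (simp add: m_def)
qed

text \<open>For r = n the remainder is an empty sum.\<close>

lemma stat_gf_rec:
  "n \<ge> 1 \<Longrightarrow> stat_gf a_cb q n = (\<Sum>k=1..n. coeff_a q n k * stat_gf a_cb q (n - k))"
  using stat_gf_expand[of n n q] by simp

section \<open>Reversal and complement\<close>

lemma bij_betw_rev: "bij_betw rev (permutations_of_set A) (permutations_of_set A)"
  by (rule bij_betw_byWitness[where f' = rev]) (auto simp: permutations_of_set_def)

text \<open>The length is \<open>n\<close> and all entries lie in \<open>{1..n}\<close>, so the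
  truncated subtraction is exact and \<open>n + 1 - x\<close> is an involution there.\<close>

lemma perm_compl_in:
  assumes "\<pi> \<in> permutations_of_set {1..n}"
  shows "perm_compl \<pi> \<in> permutations_of_set {1..n}" "perm_compl (perm_compl \<pi>) = \<pi>"
proof -
  have \<pi>: "set \<pi> = {1..n}" "distinct \<pi>" using assms by (auto simp: permutations_of_set_def)
  then have len: "length \<pi> = n" using distinct_card by fastforce
  have "(\<lambda>x. n + 1 - x) ` {1..n} = {1..n}"
  proof (intro equalityI subsetI)
    fix x assume "x \<in> {1..n}"
    then show "x \<in> (\<lambda>x. n + 1 - x) ` {1..n}"
      by (intro image_eqI[of _ _ "n + 1 - x"]) auto
  qed auto
  then show "perm_compl \<pi> \<in> permutations_of_set {1..n}"
    using \<pi> len by (auto simp: perm_compl_def permutations_of_set_def distinct_map inj_on_def)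
  show "perm_compl (perm_compl \<pi>) = \<pi>"
    using \<pi> len by (auto simp: perm_compl_def o_def intro!: map_idI)
qed

lemma bij_betw_perm_compl:
  "bij_betw perm_compl (permutations_of_set {1..n}) (permutations_of_set {1..n})"
  by (rule bij_betw_byWitness[where f' = perm_compl]) (use perm_compl_in in \<open>blast+\<close>)

lemma stat_gf_rev: "stat_gf (stat_rev \<sigma>) q n = stat_gf \<sigma> q n"
  unfolding stat_gf_def stat_rev_def by (rule sum.reindex_bij_betw[OF bij_betw_rev])

lemma stat_gf_compl: "stat_gf (stat_compl \<sigma>) q n = stat_gf \<sigma> q n"
  unfolding stat_gf_def stat_compl_def by (rule sum.reindex_bij_betw[OF bij_betw_perm_compl])

lemma stat_gf_rev_compl: "stat_gf (stat_rev_compl \<sigma>) q n = stat_gf \<sigma> q n"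
proof -
  \<comment> \<open>The complement acts on the permutation first, hence it is the outer operation on
    statistics.\<close>
  have "stat_rev_compl \<sigma> = stat_compl (stat_rev \<sigma>)"
    by (simp add: fun_eq_iff stat_rev_compl_def stat_compl_def stat_rev_def)
  then show ?thesis by (simp add: stat_gf_compl stat_gf_rev)
qed

theorem mainTheorem6:
  fixes q :: "'a::field"
  shows
    "stat_gf a_cb q 0 = 1 \<and>
     (\<forall>n\<ge>1. stat_gf a_cb q n = (\<Sum>k=1..n. coeff_a q n k * stat_gf a_cb q (n - k))) \<and>
     (\<forall>n\<ge>2. \<forall>k\<ge>2.
        coeff_a q n k = coeff_a q (n - 1) k + coeff_b q (n - 1) (k - 1) \<and>
        coeff_b q n k = coeff_b q (n - 1) k
          + (q powi (int n - int k) - 1) * coeff_b q (n - 1) (k - 1)) \<and>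
     (\<forall>n\<ge>1. coeff_a q n 1 = of_nat n \<and>
             coeff_b q n 1 = (\<Sum>i=1..n. (q powi (int i - 1) - 1))) \<and>
     (\<forall>n\<ge>1. \<forall>k\<ge>2. k \<ge> n \<longrightarrow> coeff_a q n k = 0) \<and>
     (\<forall>n\<ge>1. \<forall>k\<ge>1. k \<ge> n \<longrightarrow> coeff_b q n k = 0) \<and>
     (\<forall>\<sigma>\<in>{stat_rev a_cb, stat_compl a_cb, stat_rev_compl a_cb}. \<forall>n\<ge>1.
        stat_gf \<sigma> q n = (\<Sum>k=1..n. coeff_a q n k * stat_gf \<sigma> q (n - k)))"
proof (intro conjI allI ballI impI)
  show "stat_gf a_cb q 0 = 1"
    by (simp add: stat_gf_def a_cb_def)
next
  fix n :: nat assume "n \<ge> 1"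
  then show "stat_gf a_cb q n = (\<Sum>k=1..n. coeff_a q n k * stat_gf a_cb q (n - k))"
    by (rule stat_gf_rec)
next
  fix n k :: nat assume "n \<ge> 2" "k \<ge> 2"
  then show "coeff_a q n k = coeff_a q (n - 1) k + coeff_b q (n - 1) (k - 1)"
    using coeff_a_Suc_Suc[of q "n - 1" "k - 1"] by simp
next
  fix n k :: nat assume "n \<ge> 2" "k \<ge> 2"
  then show "coeff_b q n k = coeff_b q (n - 1) k
      + (q powi (int n - int k) - 1) * coeff_b q (n - 1) (k - 1)"
    using coeff_b_Suc_Suc[of q "n - 1" "k - 1"] by simp
next
  fix n :: nat
  show "coeff_a q n 1 = of_nat n"
    using coeff_a_eq_homog[of q n 0] by simp
  \<comment> \<open>For \<open>i \<ge> 1\<close> the integer exponent is a natural number, which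
    matches the degree-one case of \<open>homog\<close>.\<close>
  have "q powi (int i - 1) = q ^ (i - 1)" if "i \<in> {1..n}" for i
    using that by (cases i) simp_all
  then show "coeff_b q n 1 = (\<Sum>i=1..n. (q powi (int i - 1) - 1))"
    by (simp add: coeff_b_eq_homog)
next
  fix n k :: nat assume "k \<ge> 2" "k \<ge> n"
  then show "coeff_a q n k = 0" by (rule coeff_a_eq_0)
next
  fix n k :: nat assume "k \<ge> 1" "k \<ge> n"
  then show "coeff_b q n k = 0" by (rule coeff_b_eq_0)
next
  fix \<sigma> :: "nat list \<Rightarrow> nat" and n :: nat
  assume "\<sigma> \<in> {stat_rev a_cb, stat_compl a_cb, stat_rev_compl a_cb}" and n: "n \<ge> 1"
  \<comment> \<open>Equality is needed at every size \<open>m\<close>, since the recurrence also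
    involves the sizes \<open>n - k\<close>.\<close>
  then have "stat_gf \<sigma> q m = stat_gf a_cb q m" for m
    by (auto simp: stat_gf_rev stat_gf_compl stat_gf_rev_compl)
  then show "stat_gf \<sigma> q n = (\<Sum>k=1..n. coeff_a q n k * stat_gf \<sigma> q (n - k))"
    using stat_gf_rec[OF n, of q] by simp
qed

end
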